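(* Let $N=\{1,2,\ldots,n\}$, let $f:\mathbb{Z}^N\to\mathbb{R}\cup\{+\infty\}$ be a jump M$^\natural$-convex function, and let $U\subseteq N$. (1) The restriction $f_U:\mathbb{Z}^U\to\mathbb{R}\cup\{+\infty\}$, $f_U(y)=f(y,\mathbf{0}_{N\setminus U})$ $(y\in\mathbb{Z}^U)$, is jump M$^\natural$-convex, provided that $\operatorname{dom} f_U\neq\emptyset$. (2) The projection $f^U:\mathbb{Z}^U\to\mathbb{R}\cup\{+\infty,-\infty\}$, $f^U(y)=\inf\{f(y,z)\mid z\in\mathbb{Z}^{N\setminus U}\}$ $(y\in\mathbb{Z}^U)$, is jump M$^\natural$-convex, provided that $f^U>-\infty$ (i.e. $f^U(y)>-\infty$ for all $y\in\mathbb{Z}^U$).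
   Context: For $y\in\mathbb{Z}^U$ and $z\in\mathbb{Z}^{N\setminus U}$, $(y,z)\in\mathbb{Z}^N$ is the vector whose $i$th component is $y_i$ for $i\in U$ and $z_i$ for $i\in N\setminus U$; $\mathbf{0}_{N\setminus U}$ is the zero vector in $\mathbb{Z}^{N\setminus U}$. For a finite index set $N$ and a function $f:\mathbb{Z}^N\to\mathbb{R}\cup\{+\infty\}$, the effective domain is $\operatorname{dom} f=\{x\in\mathbb{Z}^N\mid f(x)<+\infty\}$; it is always assumed to be nonempty. $\mathbf{1}^i$ denotes the $i$th unit vector. For integer vectors $x,y$, let $x\vee y$ and $x\wedge y$ be the componentwise maximum and minimum, and $[x\wedge y,x\vee y]_{\mathbb{Z}}$ the set of integer vectors $z$ with $x\wedge y\le z\le x\vee y$ componentwise. A vector $s\in\mathbb{Z}^N$ is an $(x,y)$-increment if $s=\mathbf{1}^i$ or $s=-\mathbf{1}^i$ for some $i\in N$ and $x+s\in[x\wedge y,x\vee y]_{\mathbb{Z}}$. A function $f$ is jump M$^\natural$-convex if it satisfies (JM$^\natural$-EXC): for any $x,y\in\operatorname{dom} f$ and any $(x,y)$-increment $s$, (i) or (ii) holds: (i) $x+s\in\operatorname{dom} f$, $y-s\in\operatorname{dom} f$, and $f(x)+f(y)\ge f(x+s)+f(y-s)$; (ii) there exists an $(x+s,y)$-increment $t$ such that $x+s+t\in\operatorname{dom} f$, $y-s-t\in\operatorname{dom} f$, and $f(x)+f(y)\ge f(x+s+t)+f(y-s-t)$. *)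

theory Defs
  imports Main "HOL-Library.FuncSet" "HOL-Library.Extended_Real"
begin

text \<open>
  For an index set \<open>N\<close>, the elements of \<open>\<int>\<^sup>N\<close> are represented by the
  functions from \<open>N\<close> to the integers that are extensional (i.e. \<open>undefined\<close> outside \<open>N\<close>),
  so that equality of functions is equality of vectors.  A function on \<open>\<int>\<^sup>N\<close>
  is a HOL function of type \<open>('a \<Rightarrow> int) \<Rightarrow> ereal\<close> whose values outside
  \<open>int_vec N\<close> are irrelevant.
\<close>

definition int_vec :: "'a set \<Rightarrow> ('a \<Rightarrow> int) set" where
  "int_vec N = N \<rightarrow>\<^sub>E UNIV"

definition vec_zero :: "'a set \<Rightarrow> 'a \<Rightarrow> int" where
  "vec_zero N = (\<lambda>i\<in>N. 0)"

definition vec_add :: "'a set \<Rightarrow> ('a \<Rightarrow> int) \<Rightarrow> ('a \<Rightarrow> int) \<Rightarrow> 'a \<Rightarrow> int" where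
  "vec_add N x y = (\<lambda>i\<in>N. x i + y i)"

definition vec_diff :: "'a set \<Rightarrow> ('a \<Rightarrow> int) \<Rightarrow> ('a \<Rightarrow> int) \<Rightarrow> 'a \<Rightarrow> int" where
  "vec_diff N x y = (\<lambda>i\<in>N. x i - y i)"

definition vec_uminus :: "'a set \<Rightarrow> ('a \<Rightarrow> int) \<Rightarrow> 'a \<Rightarrow> int" where
  "vec_uminus N x = (\<lambda>i\<in>N. - x i)"

definition unit_vec_at :: "'a set \<Rightarrow> 'a \<Rightarrow> 'a \<Rightarrow> int" where
  "unit_vec_at N i = (\<lambda>j\<in>N. if j = i then 1 else 0)"

definition vec_max :: "'a set \<Rightarrow> ('a \<Rightarrow> int) \<Rightarrow> ('a \<Rightarrow> int) \<Rightarrow> 'a \<Rightarrow> int" where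
  "vec_max N x y = (\<lambda>i\<in>N. max (x i) (y i))"

definition vec_min :: "'a set \<Rightarrow> ('a \<Rightarrow> int) \<Rightarrow> ('a \<Rightarrow> int) \<Rightarrow> 'a \<Rightarrow> int" where
  "vec_min N x y = (\<lambda>i\<in>N. min (x i) (y i))"

definition int_interval :: "'a set \<Rightarrow> ('a \<Rightarrow> int) \<Rightarrow> ('a \<Rightarrow> int) \<Rightarrow> ('a \<Rightarrow> int) set" where
  "int_interval N a b = {z \<in> int_vec N. \<forall>i\<in>N. a i \<le> z i \<and> z i \<le> b i}"

definition increment :: "'a set \<Rightarrow> ('a \<Rightarrow> int) \<Rightarrow> ('a \<Rightarrow> int) \<Rightarrow> ('a \<Rightarrow> int) \<Rightarrow> bool" where
  "increment N x y s \<longleftrightarrow>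
     (\<exists>i\<in>N. s = unit_vec_at N i \<or> s = vec_uminus N (unit_vec_at N i)) \<and>
     vec_add N x s \<in> int_interval N (vec_min N x y) (vec_max N x y)"

definition eff_dom :: "'a set \<Rightarrow> (('a \<Rightarrow> int) \<Rightarrow> ereal) \<Rightarrow> ('a \<Rightarrow> int) set" where
  "eff_dom N f = {x \<in> int_vec N. f x < \<infinity>}"

definition JM_nat_EXC :: "'a set \<Rightarrow> (('a \<Rightarrow> int) \<Rightarrow> ereal) \<Rightarrow> bool" where
  "JM_nat_EXC N f \<longleftrightarrow>
     (\<forall>x \<in> eff_dom N f. \<forall>y \<in> eff_dom N f. \<forall>s. increment N x y s \<longrightarrow>
        (vec_add N x s \<in> eff_dom N f \<and> vec_diff N y s \<in> eff_dom N f \<and>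
         f x + f y \<ge> f (vec_add N x s) + f (vec_diff N y s)) \<or>
        (\<exists>t. increment N (vec_add N x s) y t \<and>
           vec_add N (vec_add N x s) t \<in> eff_dom N f \<and>
           vec_diff N (vec_diff N y s) t \<in> eff_dom N f \<and>
           f x + f y \<ge> f (vec_add N (vec_add N x s) t) + f (vec_diff N (vec_diff N y s) t)))"

text \<open>
  The conjuncts before the exchange axiom are the standing assumptions on functions: the index
  set is finite, the values lie in \<open>\<real> \<union> {+\<infinity>}\<close>, and the effective
  domain is nonempty.
\<close>

definition jump_M_nat_convex :: "'a set \<Rightarrow> (('a \<Rightarrow> int) \<Rightarrow> ereal) \<Rightarrow> bool" where
  "jump_M_nat_convex N f \<longleftrightarrow>
     finite N \<and> (\<forall>x \<in> int_vec N. f x \<noteq> -\<infinity>) \<and> eff_dom N f \<noteq> {} \<and> JM_nat_EXC N f"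

text \<open>
  For \<open>y\<close> in \<open>int_vec U\<close> and \<open>z\<close> in \<open>int_vec (N - U)\<close>
  with \<open>U \<subseteq> N\<close>, \<open>override_on z y U\<close> agrees with \<open>y\<close>
  on \<open>U\<close> and with \<open>z\<close> elsewhere, so it is the vector \<open>(y, z)\<close>
  in \<open>int_vec N\<close>.
\<close>

definition restriction_fun ::
  "'a set \<Rightarrow> 'a set \<Rightarrow> (('a \<Rightarrow> int) \<Rightarrow> ereal) \<Rightarrow> ('a \<Rightarrow> int) \<Rightarrow> ereal" where
  "restriction_fun N U f y = f (override_on (vec_zero (N - U)) y U)"

definition projection_fun ::
  "'a set \<Rightarrow> 'a set \<Rightarrow> (('a \<Rightarrow> int) \<Rightarrow> ereal) \<Rightarrow> ('a \<Rightarrow> int) \<Rightarrow> ereal" where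
  "projection_fun N U f y = (INF z \<in> int_vec (N - U). f (override_on z y U))"

end

theory Submission
  imports Defs
begin

text \<open>
  The exchange axiom says that one of finitely many pairs \<open>(p, q)\<close>, obtained from
  \<open>(x, y)\<close> by moving one or two unit steps towards each other, satisfies
  \<open>f p + f q \<le> f x + f y\<close>.  Two observations carry the proof.  First
  (\<open>exchange_pairs_restrict\<close>), if \<open>s\<close> is an increment on \<open>U\<close>, padded with zeros,
  then every exchange pair on \<open>N\<close> restricts to an exchange pair on \<open>U\<close>: a second
  step \<open>t\<close> inside \<open>U\<close> is again an increment on \<open>U\<close>, and a second step outside
  \<open>U\<close> is not seen after restriction.  Secondly (\<open>exchange_pairs_between\<close>), exchange
  pairs lie between \<open>x\<close> and \<open>y\<close> and preserve the sum \<open>x + y\<close>.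

  For the restriction of \<open>f\<close>, the second observation shows that the exchange pairs of
  two vectors vanishing outside \<open>U\<close> vanish there as well, so the exchange in \<open>N\<close> is an
  exchange in \<open>U\<close>.  For the projection, the infimum need not be attained, so one lifts
  \<open>x\<close> and \<open>y\<close> to vectors whose values are within \<open>\<epsilon>/2\<close> of the infima.  This yields
  the exchange inequality up to \<open>\<epsilon>\<close> for a pair that may depend on \<open>\<epsilon>\<close>.  Since there
  are only finitely many exchange pairs in \<open>U\<close>, the minimum of their values is attained, and it
  satisfies the exact inequality.
\<close>

section \<open>Integer vectors and their restrictions\<close>

lemmas vec_defs = vec_add_def vec_diff_def vec_uminus_def unit_vec_at_def vec_zero_def

lemma int_vec_ops [simp]:
  "vec_add N x y \<in> int_vec N" "vec_diff N x y \<in> int_vec N"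
  by (auto simp: int_vec_def vec_defs)

lemma restrict_in_int_vec: "restrict x U \<in> int_vec U"
  by (simp add: int_vec_def)

lemma override_on_in_int_vec:
  assumes "U \<subseteq> N" "z \<in> int_vec (N - U)"
  shows "override_on z y U \<in> int_vec N"
  using assms by (auto simp: int_vec_def override_on_def PiE_def extensional_def)

lemma restrict_override_on: "y \<in> int_vec U \<Longrightarrow> restrict (override_on z y U) U = y"
  by (auto simp: int_vec_def override_on_def fun_eq_iff PiE_def extensional_def)

lemma override_on_restrict_restrict:
  assumes "U \<subseteq> N" "x \<in> int_vec N"
  shows "override_on (restrict x (N - U)) (restrict x U) U = x"
  using assms by (auto simp: int_vec_def override_on_def fun_eq_iff PiE_def extensional_def)

lemma restrict_vec_ops:
  assumes "U \<subseteq> N"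
  shows "restrict (vec_add N x y) U = vec_add U (restrict x U) (restrict y U)"
    and "restrict (vec_diff N x y) U = vec_diff U (restrict x U) (restrict y U)"
  using assms by (auto simp: vec_defs fun_eq_iff)

section \<open>Increments\<close>

text \<open>An increment is a unit step in a coordinate where the two vectors differ, in the
  direction of the second vector.\<close>

lemma increment_iff:
  "increment N x y s \<longleftrightarrow>
     (\<exists>i\<in>N. (x i < y i \<and> s = unit_vec_at N i) \<or>
             (y i < x i \<and> s = vec_uminus N (unit_vec_at N i)))"
proof -
  have box: "vec_add N x s \<in> int_interval N (vec_min N x y) (vec_max N x y) \<longleftrightarrow>
      (\<forall>j\<in>N. min (x j) (y j) \<le> x j + s j \<and> x j + s j \<le> max (x j) (y j))" for s
    by (simp add: int_interval_def vec_min_def vec_max_def vec_add_def int_vec_def)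
  have plus: "vec_add N x (unit_vec_at N i) \<in> int_interval N (vec_min N x y) (vec_max N x y)
      \<longleftrightarrow> x i < y i" if "i \<in> N" for i
    unfolding box using that by (auto simp: unit_vec_at_def)
  have minus: "vec_add N x (vec_uminus N (unit_vec_at N i))
        \<in> int_interval N (vec_min N x y) (vec_max N x y) \<longleftrightarrow> y i < x i" if "i \<in> N" for i
    unfolding box using that by (auto simp: unit_vec_at_def vec_uminus_def)
  show ?thesis
    unfolding increment_def using plus minus by metis
qed

lemma increment_in_int_vec: "increment N x y s \<Longrightarrow> s \<in> int_vec N"
  by (auto simp: increment_iff int_vec_def vec_defs)

lemma finite_increments:
  assumes "finite N"
  shows "finite {s. increment N x y s}"
proof (rule finite_subset)
  show "{s. increment N x y s} \<subseteq>
      unit_vec_at N ` N \<union> (\<lambda>i. vec_uminus N (unit_vec_at N i)) ` N"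
    by (auto simp: increment_iff)
qed (use assms in auto)

text \<open>Padding an increment on \<open>U\<close> with zeros gives an increment on \<open>N\<close>.\<close>

lemma increment_extend:
  assumes "U \<subseteq> N" "increment U (restrict x U) (restrict y U) s"
  shows "increment N x y (override_on (vec_zero (N - U)) s U)"
proof -
  obtain i where i: "i \<in> U" "(x i < y i \<and> s = unit_vec_at U i) \<or>
             (y i < x i \<and> s = vec_uminus U (unit_vec_at U i))"
    using assms(2) by (auto simp: increment_iff)
  have "override_on (vec_zero (N - U)) (unit_vec_at U i) U = unit_vec_at N i"
    "override_on (vec_zero (N - U)) (vec_uminus U (unit_vec_at U i)) U
       = vec_uminus N (unit_vec_at N i)"
    using i(1) assms(1) by (auto simp: override_on_def vec_defs fun_eq_iff)
  then show ?thesis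
    using i assms(1) unfolding increment_iff by (intro bexI[of _ i]) auto
qed

lemma increment_restrict:
  assumes "U \<subseteq> N" "increment N x y t"
  shows "increment U (restrict x U) (restrict y U) (restrict t U) \<or> restrict t U = vec_zero U"
proof -
  obtain i where i: "i \<in> N" "(x i < y i \<and> t = unit_vec_at N i) \<or>
             (y i < x i \<and> t = vec_uminus N (unit_vec_at N i))"
    using assms(2) unfolding increment_iff by blast
  show ?thesis
  proof (cases "i \<in> U")
    case True
    have "restrict (unit_vec_at N i) U = unit_vec_at U i"
      "restrict (vec_uminus N (unit_vec_at N i)) U = vec_uminus U (unit_vec_at U i)"
      using assms(1) by (auto simp: vec_defs fun_eq_iff)
    with True i show ?thesis
      unfolding increment_iff by (metis restrict_apply')
  next
    case False
    then have "restrict t U = vec_zero U"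
      using i assms(1) by (auto simp: vec_defs fun_eq_iff)
    then show ?thesis ..
  qed
qed

section \<open>Exchange pairs\<close>

text \<open>The pairs that the exchange axiom offers as replacements for \<open>(x, y)\<close>, given the
  increment \<open>s\<close>: the pair after one step, and the pairs after a second step \<open>t\<close>.\<close>

definition exchange_pairs ::
  "'a set \<Rightarrow> ('a \<Rightarrow> int) \<Rightarrow> ('a \<Rightarrow> int) \<Rightarrow> ('a \<Rightarrow> int) \<Rightarrow> (('a \<Rightarrow> int) \<times> ('a \<Rightarrow> int)) set" where
  "exchange_pairs N x y s =
     insert (vec_add N x s, vec_diff N y s)
       ((\<lambda>t. (vec_add N (vec_add N x s) t, vec_diff N (vec_diff N y s) t)) `
          {t. increment N (vec_add N x s) y t})"

lemma finite_exchange_pairs: "finite N \<Longrightarrow> finite (exchange_pairs N x y s)"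
  by (simp add: exchange_pairs_def finite_increments)

lemma exchange_pairs_in_int_vec:
  "(p, q) \<in> exchange_pairs N x y s \<Longrightarrow> p \<in> int_vec N \<and> q \<in> int_vec N"
  by (auto simp: exchange_pairs_def)

lemma exchange_pairs_between:
  assumes "increment N x y s" "(p, q) \<in> exchange_pairs N x y s" "i \<in> N"
  shows "min (x i) (y i) \<le> p i" "p i \<le> max (x i) (y i)" "p i + q i = x i + y i"
proof -
  have step: "min (u i) (y i) \<le> u i + t i \<and> u i + t i \<le> max (u i) (y i)"
    if "increment N u y t" for u t
    using that assms(3)
    by (auto simp: increment_def int_interval_def vec_min_def vec_max_def vec_add_def)
  have s: "min (x i) (y i) \<le> x i + s i \<and> x i + s i \<le> max (x i) (y i)"
    by (rule step) (rule assms(1))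
  from assms(2) consider
      (one) "p = vec_add N x s" "q = vec_diff N y s"
    | (two) t where "increment N (vec_add N x s) y t"
        "p = vec_add N (vec_add N x s) t" "q = vec_diff N (vec_diff N y s) t"
    by (auto simp: exchange_pairs_def)
  then have "min (x i) (y i) \<le> p i \<and> p i \<le> max (x i) (y i) \<and> p i + q i = x i + y i"
  proof cases
    case one
    then show ?thesis
      using s assms(3) by (simp add: vec_add_def vec_diff_def)
  next
    case two
    then show ?thesis
      using s step[OF two(1)] assms(3) by (auto simp: vec_add_def vec_diff_def)
  qed
  then show "min (x i) (y i) \<le> p i" "p i \<le> max (x i) (y i)" "p i + q i = x i + y i"
    by auto
qed

lemma exchange_pairs_restrict:
  assumes "U \<subseteq> N" "s \<in> int_vec U"
    and "(p, q) \<in> exchange_pairs N x y (override_on (vec_zero (N - U)) s U)"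
  shows "(restrict p U, restrict q U) \<in> exchange_pairs U (restrict x U) (restrict y U) s"
proof -
  let ?s = "override_on (vec_zero (N - U)) s U"
  have s: "restrict ?s U = s"
    using assms(2) by (rule restrict_override_on)
  from assms(3) consider
      (one) "p = vec_add N x ?s" "q = vec_diff N y ?s"
    | (two) t where "increment N (vec_add N x ?s) y t"
        "p = vec_add N (vec_add N x ?s) t" "q = vec_diff N (vec_diff N y ?s) t"
    by (auto simp: exchange_pairs_def)
  then show ?thesis
  proof cases
    case one
    then show ?thesis by (simp add: restrict_vec_ops[OF assms(1)] s exchange_pairs_def)
  next
    case two
    have pq: "restrict p U = vec_add U (vec_add U (restrict x U) s) (restrict t U)"
      "restrict q U = vec_diff U (vec_diff U (restrict y U) s) (restrict t U)"
      by (simp_all add: two restrict_vec_ops[OF assms(1)] s)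
    from increment_restrict[OF assms(1) two(1)] show ?thesis
    proof
      assume "increment U (restrict (vec_add N x ?s) U) (restrict y U) (restrict t U)"
      then show ?thesis
        unfolding exchange_pairs_def pq restrict_vec_ops[OF assms(1)] s by blast
    next
      assume "restrict t U = vec_zero U"
      then have "restrict p U = vec_add U (restrict x U) s"
        "restrict q U = vec_diff U (restrict y U) s"
        unfolding pq by (auto simp: vec_defs fun_eq_iff)
      then show ?thesis by (simp add: exchange_pairs_def)
    qed
  qed
qed

text \<open>Since the right-hand side of the exchange inequality is finite and \<open>f\<close> never takes
  the value \<open>-\<infinity>\<close>, membership of the new pair in the effective domain is implied by
  the inequality.\<close>

lemma JM_nat_EXC_iff_exchange_pairs:
  assumes "\<forall>x\<in>int_vec N. f x \<noteq> -\<infinity>"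
  shows "JM_nat_EXC N f \<longleftrightarrow>
    (\<forall>x\<in>eff_dom N f. \<forall>y\<in>eff_dom N f. \<forall>s. increment N x y s \<longrightarrow>
       (\<exists>(p, q)\<in>exchange_pairs N x y s. f p + f q \<le> f x + f y))"
proof -
  have dom: "p \<in> eff_dom N f \<and> q \<in> eff_dom N f \<and> f p + f q \<le> f x + f y \<longleftrightarrow>
      f p + f q \<le> f x + f y"
    if "x \<in> eff_dom N f" "y \<in> eff_dom N f" "p \<in> int_vec N" "q \<in> int_vec N" for x y p q
  proof -
    have "f x + f y < \<infinity>"
      using that by (auto simp: eff_dom_def)
    moreover have "f p \<noteq> -\<infinity>" "f q \<noteq> -\<infinity>"
      using assms that by auto
    ultimately show ?thesis
      using that by (auto simp: eff_dom_def less_top[symmetric] top_ereal_def)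
  qed
  show ?thesis
    unfolding JM_nat_EXC_def exchange_pairs_def
    by (intro ball_cong refl all_cong1 imp_cong) (auto simp: dom)
qed

lemma jump_M_nat_convex_iff:
  "jump_M_nat_convex N f \<longleftrightarrow>
     finite N \<and> (\<forall>x\<in>int_vec N. f x \<noteq> -\<infinity>) \<and> eff_dom N f \<noteq> {} \<and>
     (\<forall>x\<in>eff_dom N f. \<forall>y\<in>eff_dom N f. \<forall>s. increment N x y s \<longrightarrow>
       (\<exists>(p, q)\<in>exchange_pairs N x y s. f p + f q \<le> f x + f y))"
  unfolding jump_M_nat_convex_def using JM_nat_EXC_iff_exchange_pairs by blast

section \<open>Restriction\<close>

lemma jump_M_nat_convex_restriction:
  assumes f: "jump_M_nat_convex N f" and U: "U \<subseteq> N"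
    and ne: "eff_dom U (restriction_fun N U f) \<noteq> {}"
  shows "jump_M_nat_convex U (restriction_fun N U f)"
proof -
  let ?E = "\<lambda>x. override_on (vec_zero (N - U)) x U"
  have zero: "vec_zero (N - U) \<in> int_vec (N - U)"
    by (simp add: int_vec_def vec_zero_def)
  have E: "?E x \<in> int_vec N" for x
    using U zero by (rule override_on_in_int_vec)
  have exch: "\<exists>(p, q)\<in>exchange_pairs U x y s.
      restriction_fun N U f p + restriction_fun N U f q
        \<le> restriction_fun N U f x + restriction_fun N U f y"
    if xy: "x \<in> eff_dom U (restriction_fun N U f)" "y \<in> eff_dom U (restriction_fun N U f)"
      and inc: "increment U x y s" for x y s
  proof -
    have dom: "?E x \<in> eff_dom N f" "?E y \<in> eff_dom N f"
      using xy E by (auto simp: eff_dom_def restriction_fun_def)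
    have r: "restrict (?E x) U = x" "restrict (?E y) U = y"
      using xy by (auto simp: eff_dom_def intro: restrict_override_on)
    have inc': "increment N (?E x) (?E y) (?E s)"
      by (rule increment_extend[OF U]) (simp only: r inc)
    then obtain p q where pq: "(p, q) \<in> exchange_pairs N (?E x) (?E y) (?E s)"
        "f p + f q \<le> f (?E x) + f (?E y)"
      using f dom unfolding jump_M_nat_convex_iff by blast
    \<comment> \<open>Both padded vectors vanish outside \<open>U\<close>, hence so does everything between them.\<close>
    have "p i = 0 \<and> q i = 0" if "i \<in> N - U" for i
      using exchange_pairs_between[OF inc' pq(1), of i] that
      by (auto simp: override_on_def vec_zero_def)
    then have "restrict p (N - U) = vec_zero (N - U)" "restrict q (N - U) = vec_zero (N - U)"
      by (auto simp: vec_zero_def fun_eq_iff)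
    then have "?E (restrict p U) = p" "?E (restrict q U) = q"
      using override_on_restrict_restrict[OF U] exchange_pairs_in_int_vec[OF pq(1)] by metis+
    then have "restriction_fun N U f (restrict p U) + restriction_fun N U f (restrict q U)
        \<le> restriction_fun N U f x + restriction_fun N U f y"
      using pq(2) by (simp add: restriction_fun_def)
    moreover have "(restrict p U, restrict q U) \<in> exchange_pairs U x y s"
      using exchange_pairs_restrict[OF U increment_in_int_vec[OF inc] pq(1)] unfolding r .
    ultimately show ?thesis by blast
  qed
  have "finite U"
    using f U by (auto simp: jump_M_nat_convex_def intro: finite_subset)
  moreover have "\<forall>x\<in>int_vec U. restriction_fun N U f x \<noteq> -\<infinity>"
    using f E by (auto simp: jump_M_nat_convex_def restriction_fun_def)
  ultimately show ?thesis
    unfolding jump_M_nat_convex_iff using ne exch by blast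
qed

section \<open>Projection\<close>

lemma projection_fun_restrict_le:
  assumes "U \<subseteq> N" "x \<in> int_vec N"
  shows "projection_fun N U f (restrict x U) \<le> f x"
proof -
  have "projection_fun N U f (restrict x U)
      \<le> f (override_on (restrict x (N - U)) (restrict x U) U)"
    unfolding projection_fun_def by (rule INF_lower) (rule restrict_in_int_vec)
  then show ?thesis
    by (simp only: override_on_restrict_restrict[OF assms])
qed

lemma projection_fun_lessE:
  assumes "U \<subseteq> N" "y \<in> int_vec U" "projection_fun N U f y < c"
  obtains x where "x \<in> int_vec N" "restrict x U = y" "f x < c"
proof -
  obtain z where z: "z \<in> int_vec (N - U)" "f (override_on z y U) < c"
    using assms(3) unfolding projection_fun_def INF_less_iff by blast
  show thesis
    using that[of "override_on z y U"] z override_on_in_int_vec[OF assms(1)]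
      restrict_override_on[OF assms(2)] by blast
qed

lemma finite_ereal_attained_le_epsilon:
  fixes v :: "'b \<Rightarrow> ereal"
  assumes "finite C" and "\<And>e::real. 0 < e \<Longrightarrow> \<exists>c\<in>C. v c \<le> A + ereal e"
  shows "\<exists>c\<in>C. v c \<le> A"
proof -
  have ne: "C \<noteq> {}"
    using assms(2)[of 1] by auto
  have "Min (v ` C) \<le> A + ereal e" if "0 < e" for e
    using assms(2)[OF that] assms(1) by (auto intro: Min_le order_trans)
  then have "Min (v ` C) \<le> A"
    by (rule ereal_le_epsilon2)
  moreover have "Min (v ` C) \<in> v ` C"
    using assms(1) ne by simp
  ultimately show ?thesis by auto
qed

lemma jump_M_nat_convex_projection:
  assumes f: "jump_M_nat_convex N f" and U: "U \<subseteq> N"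
    and bdd: "\<forall>y\<in>int_vec U. projection_fun N U f y > -\<infinity>"
  shows "jump_M_nat_convex U (projection_fun N U f)"
proof -
  let ?g = "projection_fun N U f"
  have finU: "finite U"
    using f U by (auto simp: jump_M_nat_convex_def intro: finite_subset)
  have exch: "\<exists>(p, q)\<in>exchange_pairs U x y s. ?g p + ?g q \<le> ?g x + ?g y"
    if xy: "x \<in> eff_dom U ?g" "y \<in> eff_dom U ?g" and inc: "increment U x y s" for x y s
  proof -
    have v: "x \<in> int_vec U" "y \<in> int_vec U"
      using xy by (auto simp: eff_dom_def)
    have "\<bar>?g x\<bar> \<noteq> \<infinity>" "\<bar>?g y\<bar> \<noteq> \<infinity>"
      using xy bdd v by (auto simp: eff_dom_def)
    then obtain a b where ab: "?g x = ereal a" "?g y = ereal b"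
      by (metis ereal_real')
    have "\<exists>c\<in>exchange_pairs U x y s. ?g (fst c) + ?g (snd c) \<le> ?g x + ?g y + ereal e"
      if e: "0 < e" for e
    proof -
      have "?g x < ereal (a + e/2)" "?g y < ereal (b + e/2)"
        using ab e by auto
      then obtain x' y' where x': "x' \<in> int_vec N" "restrict x' U = x" "f x' < ereal (a + e/2)"
        and y': "y' \<in> int_vec N" "restrict y' U = y" "f y' < ereal (b + e/2)"
        using v by (meson U projection_fun_lessE)
      have dom: "x' \<in> eff_dom N f" "y' \<in> eff_dom N f"
        using x' y' by (auto simp: eff_dom_def)
      let ?s = "override_on (vec_zero (N - U)) s U"
      have "increment N x' y' ?s"
        by (rule increment_extend[OF U]) (simp only: x' y' inc)
      then obtain p q where pq: "(p, q) \<in> exchange_pairs N x' y' ?s" "f p + f q \<le> f x' + f y'"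
        using f dom unfolding jump_M_nat_convex_iff by blast
      have "?g (restrict p U) + ?g (restrict q U) \<le> f p + f q"
        using exchange_pairs_in_int_vec[OF pq(1)]
        by (intro add_mono projection_fun_restrict_le[OF U]) auto
      also have "\<dots> \<le> f x' + f y'"
        by (rule pq(2))
      also have "\<dots> \<le> ereal (a + e/2) + ereal (b + e/2)"
        using x'(3) y'(3) by (intro add_mono) auto
      also have "\<dots> = ?g x + ?g y + ereal e"
        by (simp add: ab)
      finally show ?thesis
        using exchange_pairs_restrict[OF U increment_in_int_vec[OF inc] pq(1)]
        unfolding x'(2) y'(2) by (intro bexI) auto
    qed
    then have "\<exists>c\<in>exchange_pairs U x y s. ?g (fst c) + ?g (snd c) \<le> ?g x + ?g y"
      by (rule finite_ereal_attained_le_epsilon[OF finite_exchange_pairs[OF finU]])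
    then show ?thesis by (simp add: case_prod_beta)
  qed
  obtain x where "x \<in> int_vec N" "f x < \<infinity>"
    using f by (auto simp: jump_M_nat_convex_def eff_dom_def)
  then have "restrict x U \<in> eff_dom U ?g"
    using projection_fun_restrict_le[OF U, of x f] restrict_in_int_vec[of x U]
    unfolding eff_dom_def by (auto intro: le_less_trans)
  moreover have "\<forall>y\<in>int_vec U. ?g y \<noteq> -\<infinity>"
    using bdd by auto
  ultimately show ?thesis
    unfolding jump_M_nat_convex_iff using finU exch by blast
qed

section \<open>Restriction and projection preserve jump M-natural-convexity\<close>

theorem proposition4p3:
  fixes n :: nat and N U :: "nat set" and f :: "(nat \<Rightarrow> int) \<Rightarrow> ereal"
  assumes "N = {1..n}"
    and "jump_M_nat_convex N f"
    and "U \<subseteq> N"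
  shows "(eff_dom U (restriction_fun N U f) \<noteq> {} \<longrightarrow>
            jump_M_nat_convex U (restriction_fun N U f)) \<and>
         ((\<forall>y \<in> int_vec U. projection_fun N U f y > -\<infinity>) \<longrightarrow>
            jump_M_nat_convex U (projection_fun N U f))"
  using assms(2,3) jump_M_nat_convex_restriction jump_M_nat_convex_projection by blast

end
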